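(* Let $n\ge 1$ be a fixed integer. As $q\to\infty$ through prime powers, the number of distinct common zeros in $\mathbb{F}_q^n$ of a system of $n$ (not necessarily distinct) random polynomials in $\mathbb{F}_q[x_1,\dots,x_n]$ converges in distribution to a Poisson distribution with parameter $1$. Explicitly, for every integer $k\ge 0$, if $P_{q,k}\subseteq (\mathbb{F}_q[x_1,\dots,x_n])^n$ denotes the set of $n$-tuples $(f_1,\dots,f_n)$ with exactly $k$ distinct common zeros in $\mathbb{F}_q^n$, then $$\lim_{q\to\infty} d_n(P_{q,k})=\frac{e^{-1}}{k!}.$$
   Context: $\mathbb{F}_q$ denotes the finite field of order $q$. Probability on the infinite space $V=\mathbb{F}_q[x_1,\dots,x_n]$ is interpreted as asymptotic density: for an integer $t\ge 0$ let $V_t\subseteq V$ be the subspace of polynomials of total degree at most $t$ (including $0$); for $A\subseteq V^n$ the density is $d_n(A)=\lim_{t\to\infty}|A\cap V_t^n|/|V_t^n|$, provided the limit exists (its existence for $A=P_{q,k}$ is part of the assertion). *)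

theory Defs
  imports
    Complex_Main
    "HOL-Library.FuncSet"
    "HOL-Algebra.Indexed_Polynomials"
    "HOL-Number_Theory.Prime_Powers"
begin

text \<open>
  A polynomial in \<open>n\<close> variables over \<open>R\<close> is its coefficient function: the monomial
  \<open>\<Prod>i<n. x\<^sub>i ^ count m i\<close> is the multiset \<open>m\<close> over \<open>{..<n}\<close>, and its total degree is \<open>size m\<close>.
  Elements of \<open>X\<^sup>n\<close>, for both points and systems of polynomials, are the
  functions in \<open>{..<n} \<rightarrow>\<^sub>E X\<close>.
\<close>

context ring
begin

definition mpolys :: "nat \<Rightarrow> (nat multiset \<Rightarrow> 'a) set"
  where "mpolys n = indexed_pset {..<n} (carrier R)"

definition mpolys_degree_le :: "nat \<Rightarrow> nat \<Rightarrow> (nat multiset \<Rightarrow> 'a) set"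
  where "mpolys_degree_le n t = {p \<in> mpolys n. \<forall>m. p m \<noteq> \<zero> \<longrightarrow> size m \<le> t}"

definition mpoly_eval :: "nat \<Rightarrow> (nat multiset \<Rightarrow> 'a) \<Rightarrow> (nat \<Rightarrow> 'a) \<Rightarrow> 'a"
  where "mpoly_eval n p x =
    (\<Oplus>m\<in>{m. p m \<noteq> \<zero>}. p m \<otimes> (\<Otimes>i\<in>{..<n}. x i [^] count m i))"

definition common_zeros :: "nat \<Rightarrow> (nat \<Rightarrow> nat multiset \<Rightarrow> 'a) \<Rightarrow> (nat \<Rightarrow> 'a) set"
  where "common_zeros n f =
    {x \<in> {..<n} \<rightarrow>\<^sub>E carrier R. \<forall>i<n. mpoly_eval n (f i) x = \<zero>}"

definition systems_with_zeros :: "nat \<Rightarrow> nat \<Rightarrow> (nat \<Rightarrow> nat multiset \<Rightarrow> 'a) set"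
  where "systems_with_zeros n k =
    {f \<in> {..<n} \<rightarrow>\<^sub>E mpolys n. finite (common_zeros n f) \<and> card (common_zeros n f) = k}"

definition proportion :: "nat \<Rightarrow> (nat \<Rightarrow> nat multiset \<Rightarrow> 'a) set \<Rightarrow> nat \<Rightarrow> real"
  where "proportion n A t =
    real (card (A \<inter> ({..<n} \<rightarrow>\<^sub>E mpolys_degree_le n t))) /
    real (card ({..<n} \<rightarrow>\<^sub>E mpolys_degree_le n t))"

definition has_density :: "nat \<Rightarrow> (nat \<Rightarrow> nat multiset \<Rightarrow> 'a) set \<Rightarrow> bool"
  where "has_density n A \<longleftrightarrow> convergent (proportion n A)"

text \<open>Only meaningful if \<open>has_density n A\<close> holds.\<close>

definition density :: "nat \<Rightarrow> (nat \<Rightarrow> nat multiset \<Rightarrow> 'a) set \<Rightarrow> real"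
  where "density n A = lim (proportion n A)"

end

end

theory Submission
  imports Defs
begin

text \<open>
  Over a field with \<open>q\<close> elements, let \<open>P\<close> be the set of the \<open>N = q ^ n\<close> points. Evaluation at
  all points is an additive map from the finite group of polynomials of degree at most \<open>t\<close> to the
  group of functions on \<open>P\<close>. Every function on \<open>P\<close> is the value of some polynomial
  (\<open>exists_interpolating_mpoly\<close>), and there are finitely many functions, so for all large \<open>t\<close>
  evaluation is onto. Its fibres are then cosets of its kernel and have the same size
  (\<open>card_mpoly_eval_fibre\<close>). Hence the values of a random system of \<open>n\<close> polynomials form a
  uniformly distributed function \<open>H\<close> from \<open>P\<close> to the set of \<open>n\<close>-tuples over the field
  (\<open>card_system_values_fibre\<close>), a set that also has \<open>N\<close> elements.

  The common zeros are the points that \<open>H\<close> sends to the zero tuple. Each point is a zero with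
  probability \<open>1 / N\<close>, independently of the others, so for all large \<open>t\<close> the number of zeros is
  exactly binomially distributed with \<open>N\<close> trials and success probability \<open>1 / N\<close>. The proportion
  is therefore eventually constant in \<open>t\<close>, which gives the existence and the value of the density
  (\<open>density_systems_with_zeros\<close>). As \<open>q\<close> grows, so does \<open>N\<close>, and the classical Poisson limit
  (\<open>binomial_Poisson_limit\<close>) finishes the proof.
\<close>

section \<open>Counting functions by the size of a fibre\<close>

lemma card_eq_card_times_fibre:
  assumes "finite S" "finite T" "\<phi> ` S \<subseteq> T"
    and "\<And>h. h \<in> T \<Longrightarrow> card {s \<in> S. \<phi> s = h} = c"
  shows "card S = card T * c"
proof -
  have "card S = (\<Sum>h\<in>T. card {s \<in> S. \<phi> s = h})"
    using sum.group[OF assms(1-3), of "\<lambda>_. 1 :: nat"] by simp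
  also have "\<dots> = card T * c"
    using assms(4) by simp
  finally show ?thesis .
qed

text \<open>
  The level set is a \<open>k\<close>-subset \<open>Z\<close> of \<open>P\<close>; once \<open>Z\<close> is fixed, the value at each point outside
  \<open>Z\<close> is any element of \<open>B\<close> other than \<open>z\<close>. Divided by the number of all functions, this is the
  binomial probability of \<open>k\<close> successes when each has probability \<open>1 / card B\<close>.
\<close>

lemma card_PiE_level_set:
  assumes "finite P" "finite B" "z \<in> B"
  shows "card {H \<in> P \<rightarrow>\<^sub>E B. card {x \<in> P. H x = z} = k} =
    (card P choose k) * (card B - 1) ^ (card P - k)"
proof -
  let ?S = "{H \<in> P \<rightarrow>\<^sub>E B. card {x \<in> P. H x = z} = k}"
  let ?T = "{Z. Z \<subseteq> P \<and> card Z = k}"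
  have "card {H \<in> ?S. {x \<in> P. H x = z} = Z} = (card B - 1) ^ (card P - k)" if "Z \<in> ?T" for Z
  proof -
    have "{H \<in> ?S. {x \<in> P. H x = z} = Z} = (\<Pi>\<^sub>E x\<in>P. if x \<in> Z then {z} else B - {z})"
    proof (intro Set.set_eqI iffI)
      fix H assume "H \<in> (\<Pi>\<^sub>E x\<in>P. if x \<in> Z then {z} else B - {z})"
      then have H: "H \<in> extensional P"
          "\<And>x. x \<in> P \<Longrightarrow> H x \<in> (if x \<in> Z then {z} else B - {z})"
        by (auto simp: PiE_def Pi_def)
      then have "{x \<in> P. H x = z} = Z"
        using that by (fastforce split: if_splits)
      moreover have "H x \<in> B" if "x \<in> P" for x
        using H(2)[OF that] assms(3) by (auto split: if_splits)
      ultimately show "H \<in> {H \<in> ?S. {x \<in> P. H x = z} = Z}"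
        using that H(1) by (simp add: PiE_iff)
    qed (auto simp: PiE_def Pi_def)
    also have "card \<dots> = (\<Prod>x\<in>P. if x \<in> Z then 1 else card B - 1)"
      using assms by (auto simp: card_PiE intro!: prod.cong)
    also have "\<dots> = (card B - 1) ^ card (P \<inter> - Z)"
      using assms(1) by (simp add: prod.If_cases)
    also have "card (P \<inter> - Z) = card P - k"
      using that assms(1) card_Diff_subset[of Z P] finite_subset[of Z P] by (simp flip: Diff_eq)
    finally show ?thesis .
  qed
  moreover have "finite ?S"
    using assms by (intro finite_subset[of ?S "P \<rightarrow>\<^sub>E B"] finite_PiE) auto
  ultimately have "card ?S = card ?T * (card B - 1) ^ (card P - k)"
    using assms by (intro card_eq_card_times_fibre[where \<phi> = "\<lambda>H. {x \<in> P. H x = z}"]) auto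
  then show ?thesis
    using n_subsets[OF assms(1)] by simp
qed

section \<open>The Poisson limit of the binomial distribution\<close>

text \<open>
  The quotient is a product of \<open>k\<close> factors \<open>(N - i) / (N * (k - i))\<close>, each with limit
  \<open>1 / (k - i)\<close>.
\<close>

lemma binomial_over_power_tendsto:
  "(\<lambda>N. real (N choose k) / real N ^ k) \<longlonglongrightarrow> 1 / fact k"
proof -
  have factor: "(\<lambda>N. (real N - real i) / real (k - i) / real N) \<longlonglongrightarrow> 1 / real (k - i)"
    for i
  proof -
    have "(\<lambda>N. (1 - real i * inverse (real N)) / real (k - i)) \<longlonglongrightarrow> (1 - real i * 0) / real (k - i)"
      if "i < k"
      by (intro tendsto_intros lim_inverse_n) (use that in simp)
    moreover have "\<forall>\<^sub>F N in sequentially. (1 - real i * inverse (real N)) / real (k - i) =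
        (real N - real i) / real (k - i) / real N"
      using eventually_gt_at_top[of 0] by eventually_elim (simp add: field_simps)
    ultimately show ?thesis
      by (cases "i < k") (auto dest: Lim_transform_eventually)
  qed
  have "(\<Prod>i = 0..<k. 1 / real (k - i)) = 1 / fact k"
    by (simp add: fact_prod_rev prod_dividef)
  then have "(\<lambda>N. \<Prod>i = 0..<k. (real N - real i) / real (k - i) / real N) \<longlonglongrightarrow> 1 / fact k"
    using tendsto_prod[OF factor, of "\<lambda>i. i" "{0..<k}"] by simp
  moreover have "\<forall>\<^sub>F N in sequentially. (\<Prod>i = 0..<k. (real N - real i) / real (k - i) / real N) =
      real (N choose k) / real N ^ k"
    using eventually_ge_at_top[of k]
  proof eventually_elim
    case (elim N)
    then have "real (N choose k) = (\<Prod>i = 0..<k. (real N - real i) / real (k - i))"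
      by (simp add: binomial_altdef_of_nat of_nat_diff)
    moreover have "(\<Prod>i = 0..<k. g i / real N) = (\<Prod>i = 0..<k. g i) / real N ^ k" for g
      by (simp add: prod_dividef)
    ultimately show ?case
      by (simp only:)
  qed
  ultimately show ?thesis
    by (rule Lim_transform_eventually)
qed

lemma binomial_Poisson_limit:
  "(\<lambda>N. real ((N choose k) * (N - 1) ^ (N - k)) / real (N ^ N)) \<longlonglongrightarrow> exp (- 1) / fact k"
proof -
  (* The probability is written as (N choose k) / N^k times (1 - 1/N)^N / (1 - 1/N)^k, where the
     factors have the limits 1 / k!, e^{-1} and 1. *)
  have base: "(\<lambda>N. 1 + (- 1) / real N) \<longlonglongrightarrow> 1"
    using tendsto_add[OF tendsto_const tendsto_mult[OF tendsto_const lim_inverse_n], of 1 "- 1"]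
    by (simp add: field_simps)
  have "(\<lambda>N. real (N choose k) / real N ^ k *
        ((1 + (- 1) / real N) ^ N / (1 + (- 1) / real N) ^ k))
      \<longlonglongrightarrow> 1 / fact k * (exp (- 1) / 1 ^ k)"
    by (intro tendsto_intros binomial_over_power_tendsto tendsto_exp_limit_sequentially base) simp
  moreover have "\<forall>\<^sub>F N in sequentially.
      real (N choose k) / real N ^ k * ((1 + (- 1) / real N) ^ N / (1 + (- 1) / real N) ^ k) =
      real ((N choose k) * (N - 1) ^ (N - k)) / real (N ^ N)"
    using eventually_ge_at_top[of k] eventually_gt_at_top[of 1]
  proof eventually_elim
    case (elim N)
    have base_N: "1 + (- 1) / real N = real (N - 1) / real N" "real (N - 1) \<noteq> 0"
      using elim by (auto simp: field_simps of_nat_diff)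
    have split: "a ^ N = a ^ k * a ^ (N - k)" for a :: real
      using elim by (simp flip: power_add)
    show ?case
      using elim base_N(2) unfolding base_N(1) power_divide of_nat_mult of_nat_power split[of "real (N - 1)"]
      by simp
  qed
  ultimately show ?thesis
    using Lim_transform_eventually by fastforce
qed

section \<open>Evaluation of polynomials\<close>

context cring
begin

definition monomial_value :: "nat \<Rightarrow> (nat \<Rightarrow> 'a) \<Rightarrow> nat multiset \<Rightarrow> 'a"
  where "monomial_value n x m = (\<Otimes>i\<in>{..<n}. x i [^] count m i)"

abbreviation points :: "nat \<Rightarrow> (nat \<Rightarrow> 'a) set"
  where "points n \<equiv> {..<n} \<rightarrow>\<^sub>E carrier R"

lemma point_coordinate:
  "\<lbrakk>x \<in> points n; i < n\<rbrakk> \<Longrightarrow> x i \<in> carrier R"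
  by auto

lemma monomial_value_closed:
  "x \<in> points n \<Longrightarrow> monomial_value n x m \<in> carrier R"
  unfolding monomial_value_def by (intro finprod_closed) auto

lemma monomial_value_empty:
  "monomial_value n x {#} = \<one>"
  unfolding monomial_value_def by simp

lemma monomial_value_add_mset:
  assumes "x \<in> points n" "i < n"
  shows "monomial_value n x (add_mset i m) = x i \<otimes> monomial_value n x m"
proof -
  have step: "x j [^] count (add_mset i m) j = (if j = i then x j else \<one>) \<otimes> x j [^] count m j"
    if "j < n" for j
  proof -
    have x_j: "x j \<in> carrier R"
      using that by (rule point_coordinate[OF assms(1)])
    show ?thesis
    proof (cases "j = i")
      case True
      show ?thesis
        using x_j unfolding True by (simp add: m_comm)
    qed (use x_j in simp)
  qed
  have "monomial_value n x (add_mset i m) =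
      (\<Otimes>j\<in>{..<n}. (if j = i then x j else \<one>) \<otimes> x j [^] count m j)"
    unfolding monomial_value_def
    by (intro finprod_cong' step) (auto simp: point_coordinate[OF assms(1)])
  also have "\<dots> = (\<Otimes>j\<in>{..<n}. if j = i then x j else \<one>) \<otimes> monomial_value n x m"
    unfolding monomial_value_def
    by (intro finprod_multf) (auto simp: point_coordinate[OF assms(1)])
  also have "(\<Otimes>j\<in>{..<n}. if j = i then x j else \<one>) = x i"
    using assms(2) by (intro finprod_singleton_swap) (auto simp: point_coordinate[OF assms(1)])
  finally show ?thesis .
qed

lemma mpolys_coeff_closed: "p \<in> mpolys n \<Longrightarrow> p m \<in> carrier R"
  using indexed_pset_in_carrier[of "carrier R" p "{..<n}"]
  by (simp add: mpolys_def carrier_coeff_def)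

lemma mpolys_finite_support: "p \<in> mpolys n \<Longrightarrow> finite {m. p m \<noteq> \<zero>}"
  unfolding mpolys_def
proof (induction p rule: indexed_pset.induct)
  case (indexed_const k)
  have "{m. indexed_const k m \<noteq> \<zero>} \<subseteq> {{#}}"
    by (auto simp: indexed_const_def)
  then show ?case
    by (rule finite_subset) simp
next
  case (indexed_padd P Q)
  have "{m. indexed_padd P Q m \<noteq> \<zero>} \<subseteq> {m. P m \<noteq> \<zero>} \<union> {m. Q m \<noteq> \<zero>}"
    by (auto simp: indexed_padd_def)
  then show ?case
    using indexed_padd.IH by (auto intro: finite_subset)
next
  case (indexed_pmult P i)
  have "{m. indexed_pmult P i m \<noteq> \<zero>} \<subseteq> add_mset i ` {m. P m \<noteq> \<zero>}"
  proof
    fix m assume "m \<in> {m. indexed_pmult P i m \<noteq> \<zero>}"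
    then have "i \<in># m" "P (m - {#i#}) \<noteq> \<zero>"
      by (auto simp: indexed_pmult_def split: if_splits)
    then show "m \<in> add_mset i ` {m. P m \<noteq> \<zero>}"
      by (intro image_eqI[of _ _ "m - {#i#}"]) auto
  qed
  then show ?case
    using indexed_pmult.IH by (auto intro: finite_subset)
qed

lemma mpolys_support_variables: "p \<in> mpolys n \<Longrightarrow> p m \<noteq> \<zero> \<Longrightarrow> set_mset m \<subseteq> {..<n}"
  unfolding mpolys_def
proof (induction p arbitrary: m rule: indexed_pset.induct)
  case (indexed_pmult P i)
  then have "i \<in># m" "set_mset (m - {#i#}) \<subseteq> {..<n}"
    by (auto simp: indexed_pmult_def split: if_splits)
  then show ?case
    using indexed_pmult.hyps by (metis insert_DiffM insert_subset set_mset_add_mset_insert)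
next
  case (indexed_padd P Q)
  then show ?case
    by (metis indexed_padd_def l_zero zero_closed)
qed (auto simp: indexed_const_def split: if_splits)

text \<open>
  Evaluation sums over the support, which depends on the polynomial. Summing over a larger finite
  set allows the values of different polynomials to be compared term by term.
\<close>

lemma mpoly_eval_superset:
  assumes "finite B" "{m. p m \<noteq> \<zero>} \<subseteq> B" "\<And>m. p m \<in> carrier R" "x \<in> points n"
  shows "mpoly_eval n p x = (\<Oplus>m\<in>B. p m \<otimes> monomial_value n x m)"
  unfolding mpoly_eval_def monomial_value_def[symmetric] using assms(1-3)
  by (intro add.finprod_mono_neutral_cong_left) (auto simp: monomial_value_closed[OF assms(4)])

lemma mpoly_eval_closed:
  assumes "p \<in> mpolys n" "x \<in> points n"
  shows "mpoly_eval n p x \<in> carrier R"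
  unfolding mpoly_eval_def monomial_value_def[symmetric]
  by (intro finsum_closed)
    (auto simp: monomial_value_closed[OF assms(2)] mpolys_coeff_closed[OF assms(1)])

lemma mpoly_eval_const:
  assumes "c \<in> carrier R" "x \<in> points n"
  shows "mpoly_eval n (indexed_const c) x = c"
proof -
  have "mpoly_eval n (indexed_const c) x =
      (\<Oplus>m\<in>{{#}}. indexed_const c m \<otimes> monomial_value n x m)"
    using assms(1) by (intro mpoly_eval_superset[OF _ _ _ assms(2)]) (auto simp: indexed_const_def)
  then show ?thesis
    using assms(1) by (simp add: indexed_const_def monomial_value_empty)
qed

lemma mpoly_eval_padd:
  assumes "p \<in> mpolys n" "q \<in> mpolys n" "x \<in> points n"
  shows "mpoly_eval n (indexed_padd p q) x = mpoly_eval n p x \<oplus> mpoly_eval n q x"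
proof -
  note closed = monomial_value_closed[OF assms(3)]
  note coeff = mpolys_coeff_closed[OF assms(1)] mpolys_coeff_closed[OF assms(2)]
  let ?B = "{m. p m \<noteq> \<zero>} \<union> {m. q m \<noteq> \<zero>}"
  have fin: "finite ?B"
    using assms(1,2) by (simp add: mpolys_finite_support[of _ n])
  have "mpoly_eval n (indexed_padd p q) x =
      (\<Oplus>m\<in>?B. indexed_padd p q m \<otimes> monomial_value n x m)"
    using fin coeff
    by (intro mpoly_eval_superset[OF _ _ _ assms(3)]) (auto simp: indexed_padd_def)
  also have "\<dots> = (\<Oplus>m\<in>?B. p m \<otimes> monomial_value n x m \<oplus> q m \<otimes> monomial_value n x m)"
    using assms(1,2) coeff
    by (intro finsum_cong') (auto simp: indexed_padd_def l_distr closed)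
  also have "\<dots> = (\<Oplus>m\<in>?B. p m \<otimes> monomial_value n x m) \<oplus> (\<Oplus>m\<in>?B. q m \<otimes> monomial_value n x m)"
    using assms(1,2) coeff by (intro finsum_addf) (auto simp: closed)
  also have "\<dots> = mpoly_eval n p x \<oplus> mpoly_eval n q x"
    using fin coeff
    by (intro arg_cong2[where f = "(\<oplus>)"] mpoly_eval_superset[OF _ _ _ assms(3), symmetric]) auto
  finally show ?thesis .
qed

lemma mpoly_eval_pmult:
  assumes "p \<in> mpolys n" "i < n" "x \<in> points n"
  shows "mpoly_eval n (indexed_pmult p i) x = x i \<otimes> mpoly_eval n p x"
proof -
  note closed = monomial_value_closed[OF assms(3)] point_coordinate[OF assms(3,2)]
  note coeff = mpolys_coeff_closed[OF assms(1)]
  let ?B = "{m. p m \<noteq> \<zero>}"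
  have fin: "finite ?B"
    using assms(1,2) by (simp add: mpolys_finite_support[of _ n])
  have supp: "{m. indexed_pmult p i m \<noteq> \<zero>} = add_mset i ` ?B"
  proof (intro Set.set_eqI iffI)
    fix m assume "m \<in> {m. indexed_pmult p i m \<noteq> \<zero>}"
    then have "i \<in># m" "p (m - {#i#}) \<noteq> \<zero>"
      by (auto simp: indexed_pmult_def split: if_splits)
    then show "m \<in> add_mset i ` ?B"
      by (intro image_eqI[of _ _ "m - {#i#}"]) auto
  qed (auto simp: indexed_pmult_def)
  have "mpoly_eval n (indexed_pmult p i) x =
      (\<Oplus>m\<in>add_mset i ` ?B. indexed_pmult p i m \<otimes> monomial_value n x m)"
    using fin coeff supp
    by (intro mpoly_eval_superset[OF _ _ _ assms(3)]) (auto simp: indexed_pmult_def)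
  also have "\<dots> = (\<Oplus>m\<in>?B. indexed_pmult p i (add_mset i m) \<otimes> monomial_value n x (add_mset i m))"
    using assms(1,2) coeff
    by (intro finsum_reindex) (auto simp: indexed_pmult_def closed inj_on_def)
  also have "\<dots> = (\<Oplus>m\<in>?B. x i \<otimes> (p m \<otimes> monomial_value n x m))"
    using assms(1,2) coeff
    by (intro finsum_cong')
      (auto simp: indexed_pmult_def monomial_value_add_mset[OF assms(3,2)] closed
        m_lcomm)
  also have "\<dots> = x i \<otimes> (\<Oplus>m\<in>?B. p m \<otimes> monomial_value n x m)"
    using assms(1,2) coeff fin
    by (intro finsum_rdistr[symmetric]) (auto simp: closed)
  also have "\<dots> = x i \<otimes> mpoly_eval n p x"
    unfolding mpoly_eval_def monomial_value_def ..
  finally show ?thesis .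
qed

definition indexed_smult :: "'a \<Rightarrow> (nat multiset \<Rightarrow> 'a) \<Rightarrow> nat multiset \<Rightarrow> 'a"
  where "indexed_smult c p = (\<lambda>m. c \<otimes> p m)"

lemma mpolys_smult:
  assumes "c \<in> carrier R" "p \<in> mpolys n"
  shows "indexed_smult c p \<in> mpolys n"
  using assms(2) unfolding mpolys_def
proof (induction p rule: indexed_pset.induct)
  case (indexed_const k)
  have "indexed_smult c (indexed_const k) = indexed_const (c \<otimes> k)"
    using assms(1) by (auto simp: indexed_smult_def indexed_const_def)
  then show ?case
    using assms(1) indexed_const by (simp add: indexed_pset.indexed_const)
next
  case (indexed_padd P Q)
  then have "indexed_smult c (indexed_padd P Q) =
      indexed_padd (indexed_smult c P) (indexed_smult c Q)"
    using assms(1) mpolys_coeff_closed[of P n] mpolys_coeff_closed[of Q n]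
    by (auto simp: indexed_smult_def indexed_padd_def r_distr mpolys_def)
  then show ?case
    using indexed_padd.IH by (simp add: indexed_pset.indexed_padd)
next
  case (indexed_pmult P i)
  have "indexed_smult c (indexed_pmult P i) = indexed_pmult (indexed_smult c P) i"
    using assms(1) by (auto simp: indexed_smult_def indexed_pmult_def)
  then show ?case
    using indexed_pmult by (simp add: indexed_pset.indexed_pmult)
qed

lemma mpoly_eval_smult:
  assumes "c \<in> carrier R" "p \<in> mpolys n" "x \<in> points n"
  shows "mpoly_eval n (indexed_smult c p) x = c \<otimes> mpoly_eval n p x"
proof -
  note closed = monomial_value_closed[OF assms(3)]
  note coeff = mpolys_coeff_closed[OF assms(2)]
  let ?B = "{m. p m \<noteq> \<zero>}"
  have fin: "finite ?B"
    using assms(1,2) by (simp add: mpolys_finite_support[of _ n])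
  have "mpoly_eval n (indexed_smult c p) x = (\<Oplus>m\<in>?B. c \<otimes> p m \<otimes> monomial_value n x m)"
    using assms(1) fin coeff
    by (subst mpoly_eval_superset[OF _ _ _ assms(3), of ?B]) (auto simp: indexed_smult_def)
  also have "\<dots> = (\<Oplus>m\<in>?B. c \<otimes> (p m \<otimes> monomial_value n x m))"
    using assms(1,2) coeff by (intro finsum_cong') (auto simp: closed m_assoc)
  also have "\<dots> = c \<otimes> (\<Oplus>m\<in>?B. p m \<otimes> monomial_value n x m)"
    using assms(1,2) coeff fin
    by (intro finsum_rdistr[symmetric]) (auto simp: closed)
  also have "\<dots> = c \<otimes> mpoly_eval n p x"
    unfolding mpoly_eval_def monomial_value_def ..
  finally show ?thesis .
qed

lemma mpolys_const: "c \<in> carrier R \<Longrightarrow> indexed_const c \<in> mpolys n"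
  unfolding mpolys_def by (rule indexed_pset.indexed_const)

lemma mpolys_padd: "p \<in> mpolys n \<Longrightarrow> q \<in> mpolys n \<Longrightarrow> indexed_padd p q \<in> mpolys n"
  unfolding mpolys_def by (rule indexed_pset.indexed_padd)

lemma mpolys_pmult: "p \<in> mpolys n \<Longrightarrow> i < n \<Longrightarrow> indexed_pmult p i \<in> mpolys n"
  unfolding mpolys_def by (rule indexed_pset.indexed_pmult) auto

lemma mpolys_degree_le_mono: "s \<le> t \<Longrightarrow> mpolys_degree_le n s \<subseteq> mpolys_degree_le n t"
  unfolding mpolys_degree_le_def by force

lemma mpolys_degree_leD: "p \<in> mpolys_degree_le n t \<Longrightarrow> p \<in> mpolys n"
  unfolding mpolys_degree_le_def by simp

lemma mpolys_degree_le_zero: "indexed_const \<zero> \<in> mpolys_degree_le n t"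
  unfolding mpolys_degree_le_def by (simp add: mpolys_const indexed_zero_def[symmetric])
    (simp add: indexed_zero_def)

lemma mpolys_degree_le_padd:
  "p \<in> mpolys_degree_le n t \<Longrightarrow> q \<in> mpolys_degree_le n t \<Longrightarrow>
    indexed_padd p q \<in> mpolys_degree_le n t"
  unfolding mpolys_degree_le_def
  by (auto simp: mpolys_padd) (metis indexed_padd_def l_zero zero_closed)

lemma mpolys_degree_le_smult:
  "c \<in> carrier R \<Longrightarrow> p \<in> mpolys_degree_le n t \<Longrightarrow> indexed_smult c p \<in> mpolys_degree_le n t"
  unfolding mpolys_degree_le_def
  by (auto simp: mpolys_smult) (metis indexed_smult_def r_null)

lemma mpolys_degree_bounded:
  assumes "p \<in> mpolys n"
  obtains t where "p \<in> mpolys_degree_le n t"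
proof
  have "finite (size ` {m. p m \<noteq> \<zero>})"
    using mpolys_finite_support[OF assms] by simp
  then show "p \<in> mpolys_degree_le n (Max (size ` {m. p m \<noteq> \<zero>}))"
    using assms by (auto simp: mpolys_degree_le_def)
qed

text \<open>
  Such a polynomial is determined by its coefficients at the finitely many monomials of degree at
  most \<open>t\<close> in the variables below \<open>n\<close>.
\<close>

lemma finite_mpolys_degree_le:
  assumes "finite (carrier R)"
  shows "finite (mpolys_degree_le n t)"
proof -
  let ?M = "{m :: nat multiset. set_mset m \<subseteq> {..<n} \<and> size m \<le> t}"
  have "?M = (\<Union>s\<le>t. {m. set_mset m \<subseteq> {..<n} \<and> size m = s})"
    by auto
  moreover have "finite {m. set_mset m \<subseteq> {..<n} \<and> size m = s}" for s
    using finite_multisets_of_size[of "{..<n}" s] by (simp add: multisets_of_size_def)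
  ultimately have "finite ?M"
    by simp
  then have "finite {p. \<forall>m. (m \<in> ?M \<longrightarrow> p m \<in> carrier R) \<and> (m \<notin> ?M \<longrightarrow> p m = \<zero>)}"
    using assms by (rule finite_set_of_finite_funs)
  then show ?thesis
    by (rule rev_finite_subset)
      (auto simp: mpolys_degree_le_def intro: mpolys_coeff_closed dest: mpolys_support_variables)
qed

end

section \<open>Interpolation and the fibres of evaluation\<close>

context cring
begin

text \<open>
  The sum on the left is the product of \<open>p\<close> with the polynomial \<open>x\<^sub>i - c\<close>. Products with such
  linear factors are all the multiplication that interpolation needs.
\<close>

lemma mpoly_eval_linear_factor:
  assumes "p \<in> mpolys n" "i < n" "c \<in> carrier R" "x \<in> points n"
  shows "mpoly_eval n (indexed_padd (indexed_pmult p i) (indexed_smult (\<ominus> c) p)) x =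
    (x i \<ominus> c) \<otimes> mpoly_eval n p x"
proof -
  have "x i \<in> carrier R" "mpoly_eval n p x \<in> carrier R"
    using assms by (auto intro: point_coordinate mpoly_eval_closed)
  then show ?thesis
    using assms(3)
    by (simp add: mpoly_eval_padd[OF mpolys_pmult mpolys_smult] mpoly_eval_pmult mpoly_eval_smult
        assms minus_eq l_distr)
qed

definition vanishing_mpolys :: "nat \<Rightarrow> nat \<Rightarrow> (nat multiset \<Rightarrow> 'a) set"
  where "vanishing_mpolys n t =
    {p \<in> mpolys_degree_le n t. \<forall>x\<in>points n. mpoly_eval n p x = \<zero>}"

text \<open>
  A nonempty fibre is a coset of the kernel: adding \<open>p\<^sub>0\<close> is a bijection from the kernel onto the
  fibre of \<open>p\<^sub>0\<close>, and adding \<open>- p\<^sub>0\<close> is its inverse.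
\<close>

lemma card_mpoly_eval_fibre:
  assumes "p\<^sub>0 \<in> mpolys_degree_le n t" "\<And>x. x \<in> points n \<Longrightarrow> mpoly_eval n p\<^sub>0 x = g x"
  shows "card {p \<in> mpolys_degree_le n t. \<forall>x\<in>points n. mpoly_eval n p x = g x} =
    card (vanishing_mpolys n t)"
proof -
  let ?V = "mpolys_degree_le n t"
  let ?F = "{p \<in> ?V. \<forall>x\<in>points n. mpoly_eval n p x = g x}"
  let ?neg = "indexed_smult (\<ominus> \<one>) p\<^sub>0"
  note p0 = mpolys_degree_leD[OF assms(1)]
  have neg: "?neg \<in> ?V"
    using assms(1) by (intro mpolys_degree_le_smult) auto
  have coeff: "q m \<in> carrier R" if "q \<in> ?V" for q m
    using that by (blast intro: mpolys_coeff_closed mpolys_degree_leD)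
  have eval_closed: "mpoly_eval n p\<^sub>0 x \<in> carrier R" if "x \<in> points n" for x
    using p0 that by (rule mpoly_eval_closed)
  have "bij_betw (indexed_padd p\<^sub>0) (vanishing_mpolys n t) ?F"
  proof (rule bij_betw_byWitness[where f' = "indexed_padd ?neg"])
    show "\<forall>q\<in>vanishing_mpolys n t. indexed_padd ?neg (indexed_padd p\<^sub>0 q) = q"
      using assms(1)
      by (auto simp: vanishing_mpolys_def indexed_padd_def indexed_smult_def coeff l_minus r_neg1)
    show "\<forall>q\<in>?F. indexed_padd p\<^sub>0 (indexed_padd ?neg q) = q"
      using assms(1)
      by (auto simp: indexed_padd_def indexed_smult_def coeff l_minus r_neg2)
    show "indexed_padd p\<^sub>0 ` vanishing_mpolys n t \<subseteq> ?F"
    proof (intro image_subsetI CollectI conjI ballI)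
      fix q x assume q: "q \<in> vanishing_mpolys n t"
      show "indexed_padd p\<^sub>0 q \<in> ?V"
        using q assms(1) by (simp add: vanishing_mpolys_def mpolys_degree_le_padd)
      assume x: "x \<in> points n"
      have "mpoly_eval n (indexed_padd p\<^sub>0 q) x = mpoly_eval n p\<^sub>0 x \<oplus> mpoly_eval n q x"
        using q p0 x by (intro mpoly_eval_padd) (auto simp: vanishing_mpolys_def mpolys_degree_leD)
      then show "mpoly_eval n (indexed_padd p\<^sub>0 q) x = g x"
        using q x assms(2)[OF x] eval_closed[OF x] by (simp add: vanishing_mpolys_def)
    qed
    show "indexed_padd ?neg ` ?F \<subseteq> vanishing_mpolys n t"
      unfolding vanishing_mpolys_def
    proof (intro image_subsetI CollectI conjI ballI)
      fix q x assume q: "q \<in> ?F"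
      show "indexed_padd ?neg q \<in> ?V"
        using q neg by (simp add: mpolys_degree_le_padd)
      assume x: "x \<in> points n"
      have "mpoly_eval n (indexed_padd ?neg q) x = mpoly_eval n ?neg x \<oplus> mpoly_eval n q x"
        using q neg x by (intro mpoly_eval_padd) (auto simp: mpolys_degree_leD)
      also have "mpoly_eval n ?neg x = \<ominus> mpoly_eval n p\<^sub>0 x"
        using p0 x eval_closed[OF x] by (simp add: mpoly_eval_smult l_minus)
      also have "mpoly_eval n q x = mpoly_eval n p\<^sub>0 x"
        using q x assms(2)[OF x] by simp
      finally show "mpoly_eval n (indexed_padd ?neg q) x = \<zero>"
        using eval_closed[OF x] by (simp add: l_neg)
    qed
  qed
  then show ?thesis
    by (rule bij_betw_same_card[symmetric])
qed

lemma finite_points: "finite (carrier R) \<Longrightarrow> finite (points n)"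
  by (simp add: finite_PiE)

lemma card_points: "card (points n) = card (carrier R) ^ n"
  by (simp add: card_PiE)

text \<open>
  The two restrictions make the result a member of \<open>points n \<rightarrow>\<^sub>E points n\<close>, so that functions with
  equal values are equal and can be counted: the points serve both as arguments and as
  \<open>n\<close>-tuples of values.
\<close>

definition system_values :: "nat \<Rightarrow> (nat \<Rightarrow> nat multiset \<Rightarrow> 'a) \<Rightarrow> (nat \<Rightarrow> 'a) \<Rightarrow> nat \<Rightarrow> 'a"
  where "system_values n f = (\<lambda>x\<in>points n. \<lambda>i\<in>{..<n}. mpoly_eval n (f i) x)"

lemma system_values_in_points:
  assumes "f \<in> {..<n} \<rightarrow>\<^sub>E mpolys n"
  shows "system_values n f \<in> points n \<rightarrow>\<^sub>E points n"
  unfolding system_values_def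
  by (intro restrict_PiE_iff[THEN iffD2] ballI mpoly_eval_closed PiE_mem[OF assms])

lemma common_zeros_eq_level_set:
  "common_zeros n f = {x \<in> points n. system_values n f x = (\<lambda>i\<in>{..<n}. \<zero>)}"
  unfolding common_zeros_def system_values_def
  by (intro Collect_cong conj_cong refl) (auto simp: restrict_def fun_eq_iff)

text \<open>
  Prescribing the values of a system prescribes those of each of its \<open>n\<close> polynomials separately, so
  the fibre is a product of \<open>n\<close> fibres of evaluation. The size does not depend on \<open>H\<close>: the values of
  a random system are uniformly distributed.
\<close>

lemma card_system_values_fibre:
  assumes "H \<in> points n \<rightarrow>\<^sub>E points n"
    and interpolate: "\<And>g. g \<in> points n \<rightarrow>\<^sub>E carrier R \<Longrightarrow>
      \<exists>p\<in>mpolys_degree_le n t. \<forall>x\<in>points n. mpoly_eval n p x = g x"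
  shows "card {f \<in> {..<n} \<rightarrow>\<^sub>E mpolys_degree_le n t. system_values n f = H} =
    card (vanishing_mpolys n t) ^ n"
proof -
  let ?V = "mpolys_degree_le n t"
  let ?F = "\<lambda>i. {p \<in> ?V. \<forall>x\<in>points n. mpoly_eval n p x = H x i}"
  have H_point: "H x \<in> points n" if "x \<in> points n" for x
    using assms(1) that by (rule PiE_mem)
  have eq: "system_values n f = H \<longleftrightarrow> (\<forall>x\<in>points n. \<forall>i<n. mpoly_eval n (f i) x = H x i)" for f
  proof
    assume "\<forall>x\<in>points n. \<forall>i<n. mpoly_eval n (f i) x = H x i"
    then have "system_values n f x = H x" if "x \<in> points n" for x
      using H_point[OF that] that
      by (intro extensionalityI[of _ "{..<n}"]) (auto simp: system_values_def PiE_def)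
    then show "system_values n f = H"
      using assms(1) by (intro extensionalityI[of _ "points n"]) (auto simp: system_values_def PiE_def)
  next
    assume H: "system_values n f = H"
    show "\<forall>x\<in>points n. \<forall>i<n. mpoly_eval n (f i) x = H x i"
      unfolding H[symmetric] system_values_def by simp
  qed
  have "f \<in> {f \<in> {..<n} \<rightarrow>\<^sub>E ?V. system_values n f = H} \<longleftrightarrow> f \<in> (\<Pi>\<^sub>E i\<in>{..<n}. ?F i)" for f
    unfolding eq mem_Collect_eq PiE_iff lessThan_iff by blast
  then have "{f \<in> {..<n} \<rightarrow>\<^sub>E ?V. system_values n f = H} = (\<Pi>\<^sub>E i\<in>{..<n}. ?F i)"
    by (rule Set.set_eqI)
  also have "card \<dots> = (\<Prod>i<n. card (?F i))"
    by (simp add: card_PiE)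
  also have "\<dots> = (\<Prod>i<n. card (vanishing_mpolys n t))"
  proof (rule prod.cong)
    fix i assume "i \<in> {..<n}"
    then have "(\<lambda>x\<in>points n. H x i) \<in> points n \<rightarrow>\<^sub>E carrier R"
      by (intro restrict_PiE_iff[THEN iffD2] ballI point_coordinate[OF H_point]) auto
    from interpolate[OF this] obtain p where
      "p \<in> ?V" "\<And>x. x \<in> points n \<Longrightarrow> mpoly_eval n p x = H x i"
      by auto
    then show "card (?F i) = card (vanishing_mpolys n t)"
      by (rule card_mpoly_eval_fibre)
  qed simp
  finally show ?thesis
    by simp
qed

end

context field
begin

text \<open>
  The polynomial is a product with one linear factor for each \<open>z \<in> Z\<close>: as \<open>z\<close> differs from \<open>a\<close> in
  some coordinate \<open>i\<close>, the factor \<open>x\<^sub>i - z i\<close> vanishes at \<open>z\<close> but not at \<open>a\<close>. The product does not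
  vanish at \<open>a\<close> since there are no zero divisors.
\<close>

lemma exists_separating_mpoly:
  assumes "finite Z" "Z \<subseteq> points n" "a \<in> points n" "a \<notin> Z"
  shows "\<exists>p\<in>mpolys n. mpoly_eval n p a \<noteq> \<zero> \<and> (\<forall>x\<in>Z. mpoly_eval n p x = \<zero>)"
  using assms(1,2,4)
proof (induction Z)
  case empty
  show ?case
    using assms(3) by (intro bexI[of _ "indexed_const \<one>"]) (auto simp: mpoly_eval_const mpolys_const)
next
  case (insert z Z)
  then obtain p where p: "p \<in> mpolys n" "mpoly_eval n p a \<noteq> \<zero>" "\<forall>x\<in>Z. mpoly_eval n p x = \<zero>"
    by auto
  have z: "z \<in> points n"
    using insert.prems by simp
  have "\<exists>i<n. a i \<noteq> z i"
    using PiE_ext[OF assms(3) z] insert.prems(2) by blast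
  then obtain i where i: "i < n" "a i \<noteq> z i"
    by blast
  let ?p = "indexed_padd (indexed_pmult p i) (indexed_smult (\<ominus> z i) p)"
  have z_i: "z i \<in> carrier R" and a_i: "a i \<in> carrier R"
    using point_coordinate z assms(3) i(1) by blast+
  have eval: "mpoly_eval n ?p x = (x i \<ominus> z i) \<otimes> mpoly_eval n p x" if "x \<in> points n" for x
    using p(1) i(1) z_i that by (rule mpoly_eval_linear_factor)
  have "?p \<in> mpolys n"
    using p(1) i(1) z_i by (intro mpolys_padd mpolys_pmult mpolys_smult) auto
  moreover have "mpoly_eval n ?p a \<noteq> \<zero>"
    using eval[OF assms(3)] p(2) i(2) a_i z_i mpoly_eval_closed[OF p(1) assms(3)]
    by (simp add: integral_iff)
  moreover have "mpoly_eval n ?p x = \<zero>" if "x \<in> insert z Z" for x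
  proof -
    have x: "x \<in> points n"
      using that insert.prems(1) by blast
    show ?thesis
      using that p(3) z_i eval[OF x] mpoly_eval_closed[OF p(1) x] point_coordinate[OF x i(1)]
      by (auto simp: minus_eq r_neg)
  qed
  ultimately show ?case
    by blast
qed

text \<open>
  Newton interpolation: to include one more point \<open>z\<close>, a multiple of a polynomial that vanishes at
  all earlier points but not at \<open>z\<close> corrects the value at \<open>z\<close> and changes no earlier value.
\<close>

lemma exists_interpolating_mpoly:
  assumes "finite Z" "Z \<subseteq> points n" "\<And>x. x \<in> Z \<Longrightarrow> g x \<in> carrier R"
  shows "\<exists>p\<in>mpolys n. \<forall>x\<in>Z. mpoly_eval n p x = g x"
  using assms
proof (induction Z)
  case empty
  show ?case
    by (intro bexI[of _ "indexed_const \<zero>"]) (auto simp: mpolys_const)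
next
  case (insert z Z)
  then obtain p where p: "p \<in> mpolys n" "\<forall>x\<in>Z. mpoly_eval n p x = g x"
    by auto
  have z: "z \<in> points n" and Z: "Z \<subseteq> points n" and g_z: "g z \<in> carrier R"
    using insert.prems by auto
  obtain v where v: "v \<in> mpolys n" "mpoly_eval n v z \<noteq> \<zero>" "\<forall>x\<in>Z. mpoly_eval n v x = \<zero>"
    using exists_separating_mpoly[OF insert.hyps(1) Z z insert.hyps(2)] by blast
  define c where "c = (g z \<ominus> mpoly_eval n p z) \<otimes> inv (mpoly_eval n v z)"
  let ?p = "indexed_padd p (indexed_smult c v)"
  have p_z: "mpoly_eval n p z \<in> carrier R" and v_z: "mpoly_eval n v z \<in> Units R"
    using mpoly_eval_closed[OF p(1) z] mpoly_eval_closed[OF v(1) z] v(2) by (auto simp: field_Units)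
  have c: "c \<in> carrier R"
    unfolding c_def using g_z p_z v_z by simp
  have c_v: "c \<otimes> mpoly_eval n v z = g z \<ominus> mpoly_eval n p z"
    unfolding c_def using g_z p_z v_z by (simp add: m_assoc Units_closed Units_l_inv)
  have eval: "mpoly_eval n ?p x = mpoly_eval n p x \<oplus> c \<otimes> mpoly_eval n v x" if "x \<in> points n" for x
    using p(1) v(1) c that by (simp add: mpoly_eval_padd mpolys_smult mpoly_eval_smult)
  have "mpoly_eval n ?p x = g x" if "x \<in> insert z Z" for x
  proof (cases "x = z")
    case True
    have "mpoly_eval n ?p z = mpoly_eval n p z \<oplus> (g z \<ominus> mpoly_eval n p z)"
      using eval[OF z] c_v by simp
    also have "\<dots> = g z"
      using p_z g_z by (simp add: minus_eq a_lcomm r_neg)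
    finally show ?thesis
      using True by simp
  next
    case False
    then have "x \<in> Z" "x \<in> points n"
      using that Z by auto
    then show ?thesis
      using eval p(2) v(3) c insert.prems(2) that by simp
  qed
  moreover have "?p \<in> mpolys n"
    using p v c by (intro mpolys_padd mpolys_smult)
  ultimately show ?case
    by blast
qed

text \<open>
  There are only finitely many functions to interpolate, so the largest degree among one chosen
  interpolating polynomial for each is a bound for all.
\<close>

lemma interpolation_degree_bound:
  assumes "finite (carrier R)"
  obtains t\<^sub>0 where "\<And>t g. t \<ge> t\<^sub>0 \<Longrightarrow> g \<in> points n \<rightarrow>\<^sub>E carrier R \<Longrightarrow>
    \<exists>p\<in>mpolys_degree_le n t. \<forall>x\<in>points n. mpoly_eval n p x = g x"
proof -
  let ?G = "points n \<rightarrow>\<^sub>E carrier R"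
  let ?interp = "\<lambda>g t. \<exists>p\<in>mpolys_degree_le n t. \<forall>x\<in>points n. mpoly_eval n p x = g x"
  have "\<exists>t. ?interp g t" if "g \<in> ?G" for g
  proof -
    have "\<exists>p\<in>mpolys n. \<forall>x\<in>points n. mpoly_eval n p x = g x"
      using PiE_mem[OF that] by (intro exists_interpolating_mpoly finite_points assms subset_refl)
    then obtain p where p: "p \<in> mpolys n" "\<forall>x\<in>points n. mpoly_eval n p x = g x"
      by blast
    obtain t where "p \<in> mpolys_degree_le n t"
      using p(1) by (rule mpolys_degree_bounded)
    with p(2) show ?thesis
      by (intro exI[of _ t] bexI[of _ p])
  qed
  then obtain d where d: "\<And>g. g \<in> ?G \<Longrightarrow> ?interp g (d g)"
    by metis
  have "finite ?G"
    using assms by (simp add: finite_PiE)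
  then have "d g \<le> Max (d ` ?G)" if "g \<in> ?G" for g
    using that by simp
  then have "?interp g t" if "t \<ge> Max (d ` ?G)" "g \<in> ?G" for t g
    using d[OF that(2)] mpolys_degree_le_mono[of "d g" t n] that by (meson order_trans subsetD)
  then show thesis
    by (rule that)
qed

section \<open>The density of systems with a given number of zeros\<close>

text \<open>
  Passing from systems to their values divides both cardinalities in the proportion by the common
  size \<open>c\<close> of the fibres. What remains is the share of those functions on the points that take the
  value zero exactly \<open>k\<close> times.
\<close>

lemma proportion_systems_with_zeros:
  assumes "finite (carrier R)"
    and interpolate: "\<And>g. g \<in> points n \<rightarrow>\<^sub>E carrier R \<Longrightarrow>
      \<exists>p\<in>mpolys_degree_le n t. \<forall>x\<in>points n. mpoly_eval n p x = g x"
    and N: "N = card (carrier R) ^ n"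
  shows "proportion n (systems_with_zeros n k) t =
    real ((N choose k) * (N - 1) ^ (N - k)) / real (N ^ N)"
proof -
  let ?V = "mpolys_degree_le n t"
  let ?S = "{..<n} \<rightarrow>\<^sub>E ?V"
  let ?A = "systems_with_zeros n k \<inter> ?S"
  let ?z = "\<lambda>i\<in>{..<n}. \<zero>"
  let ?T = "points n \<rightarrow>\<^sub>E points n"
  let ?T\<^sub>k = "{H \<in> ?T. card {x \<in> points n. H x = ?z} = k}"
  define c where "c = card (vanishing_mpolys n t) ^ n"
  note fin_points = finite_points[OF assms(1), of n]
  have card_P: "card (points n) = N"
    using N by (simp add: card_points)
  have fin_V: "finite ?V"
    using assms(1) by (rule finite_mpolys_degree_le)
  then have fin_S: "finite ?S"
    by (simp add: finite_PiE)
  have fin_T: "finite ?T"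
    using fin_points by (simp add: finite_PiE)
  have z: "?z \<in> points n"
    by auto
  have S_mpolys: "f \<in> {..<n} \<rightarrow>\<^sub>E mpolys n" if "f \<in> ?S" for f
    using that by (auto simp: PiE_iff intro: mpolys_degree_leD)
  then have values_T: "system_values n f \<in> ?T" if "f \<in> ?S" for f
    using that by (intro system_values_in_points)
  have A_iff: "f \<in> systems_with_zeros n k \<longleftrightarrow> system_values n f \<in> ?T\<^sub>k" if "f \<in> ?S" for f
    using S_mpolys[OF that] values_T[OF that] fin_points
    by (simp add: systems_with_zeros_def common_zeros_eq_level_set)
  have fibre: "card {f \<in> ?S. system_values n f = H} = c" if "H \<in> ?T" for H
    unfolding c_def using that interpolate by (rule card_system_values_fibre)
  have "card ?S = card ?T * c"
    by (rule card_eq_card_times_fibre[OF fin_S fin_T image_subsetI[OF values_T] fibre])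
  then have S: "card ?S = N ^ N * c"
    using fin_points card_P by (simp add: card_PiE)
  have "card ?A = card ?T\<^sub>k * c"
  proof (rule card_eq_card_times_fibre)
    fix H assume H: "H \<in> ?T\<^sub>k"
    have "f \<in> systems_with_zeros n k" if "f \<in> ?S" "system_values n f = H" for f
      using A_iff[OF that(1)] that(2) H by simp
    then have "{f \<in> ?A. system_values n f = H} = {f \<in> ?S. system_values n f = H}"
      by blast
    then show "card {f \<in> ?A. system_values n f = H} = c"
      using fibre[of H] H by simp
  next
    show "system_values n ` ?A \<subseteq> ?T\<^sub>k"
    proof (rule image_subsetI)
      fix f assume "f \<in> ?A"
      then show "system_values n f \<in> ?T\<^sub>k"
        using A_iff[of f] by simp
    qed
  qed (use fin_S fin_T in simp_all)
  then have A: "card ?A = (N choose k) * (N - 1) ^ (N - k) * c"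
    using card_PiE_level_set[OF fin_points fin_points z, of k] card_P by simp
  (* The kernel contains 0, so c is not 0 and cancels from the proportion. *)
  have "indexed_const \<zero> \<in> vanishing_mpolys n t"
    by (simp add: vanishing_mpolys_def mpolys_degree_le_zero mpoly_eval_const)
  moreover have "finite (vanishing_mpolys n t)"
    using fin_V by (simp add: vanishing_mpolys_def)
  ultimately have "c \<noteq> 0"
    by (auto simp: c_def)
  then show ?thesis
    unfolding proportion_def A S by simp
qed

lemma density_systems_with_zeros:
  assumes "finite (carrier R)" and N: "N = card (carrier R) ^ n"
  shows "has_density n (systems_with_zeros n k)"
    and "density n (systems_with_zeros n k) =
      real ((N choose k) * (N - 1) ^ (N - k)) / real (N ^ N)"
proof -
  obtain t\<^sub>0 where "\<And>t g. t \<ge> t\<^sub>0 \<Longrightarrow> g \<in> points n \<rightarrow>\<^sub>E carrier R \<Longrightarrow>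
      \<exists>p\<in>mpolys_degree_le n t. \<forall>x\<in>points n. mpoly_eval n p x = g x"
    using interpolation_degree_bound[OF assms(1)] by blast
  then have "proportion n (systems_with_zeros n k) t =
      real ((N choose k) * (N - 1) ^ (N - k)) / real (N ^ N)" if "t \<ge> t\<^sub>0" for t
    using that assms by (intro proportion_systems_with_zeros) auto
  then have "proportion n (systems_with_zeros n k) \<longlonglongrightarrow>
      real ((N choose k) * (N - 1) ^ (N - k)) / real (N ^ N)"
    by (intro tendsto_eventually) (auto simp: eventually_sequentially)
  then show "has_density n (systems_with_zeros n k)"
    and "density n (systems_with_zeros n k) =
      real ((N choose k) * (N - 1) ^ (N - k)) / real (N ^ N)"
    unfolding has_density_def density_def by (auto simp: convergent_def intro: limI)
qed

end

theorem corollary3p9: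
  fixes n :: nat and F :: "nat \<Rightarrow> ('a, 'b) ring_scheme"
  assumes "n \<ge> 1"
    and "\<And>q. primepow q \<Longrightarrow> field (F q) \<and> order (F q) = q"
  shows "\<forall>k::nat.
    (\<forall>q. primepow q \<longrightarrow>
      ring.has_density (F q) n (ring.systems_with_zeros (F q) n k)) \<and>
    ((\<lambda>q. ring.density (F q) n (ring.systems_with_zeros (F q) n k))
      \<longlongrightarrow> exp (- 1) / fact k) (inf at_top (principal {q. primepow q}))"
proof (intro allI conjI impI)
  have F: "finite (carrier (F q))" "card (carrier (F q)) = q" if "primepow q" for q
    using assms(2)[OF that] primepow_gt_0_nat[OF that] card_ge_0_finite[of "carrier (F q)"]
    by (auto simp: order_def)
  fix k
  show "ring.has_density (F q) n (ring.systems_with_zeros (F q) n k)" if "primepow q" for q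
    using assms(2)[OF that] F[OF that] field.density_systems_with_zeros(1)[of "F q" "q ^ n" n k]
    by simp
  let ?a = "\<lambda>N. real ((N choose k) * (N - 1) ^ (N - k)) / real (N ^ N)"
  have "ring.density (F q) n (ring.systems_with_zeros (F q) n k) = ?a (q ^ n)" if "primepow q" for q
    using assms(2)[OF that] F[OF that] field.density_systems_with_zeros(2)[of "F q" "q ^ n" n k]
    by simp
  then have "\<forall>\<^sub>F q in inf at_top (principal {q. primepow q}).
      ?a (q ^ n) = ring.density (F q) n (ring.systems_with_zeros (F q) n k)"
    by (simp add: eventually_inf_principal)
  (* This is where n \<ge> 1 enters: for n = 0 there is a single point for every q. *)
  moreover have "filterlim (\<lambda>q. q ^ n) at_top (inf at_top (principal {q :: nat. primepow q}))"
  proof (rule filterlim_mono[OF _ order_refl inf_le1])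
    have "q \<le> q ^ n" for q :: nat
      using assms(1) by (cases "q = 0") (auto intro: self_le_power)
    then show "filterlim (\<lambda>q :: nat. q ^ n) at_top at_top"
      by (intro filterlim_at_top_mono[OF filterlim_ident]) auto
  qed
  then have "((\<lambda>q. ?a (q ^ n)) \<longlongrightarrow> exp (- 1) / fact k) (inf at_top (principal {q. primepow q}))"
    by (rule filterlim_compose[OF binomial_Poisson_limit])
  ultimately show "((\<lambda>q. ring.density (F q) n (ring.systems_with_zeros (F q) n k))
      \<longlongrightarrow> exp (- 1) / fact k) (inf at_top (principal {q. primepow q}))"
    by (rule Lim_transform_eventually[rotated])
qed

end
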